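(* Let $q\in]0,1[$. The set of identities $$\frac{q^{mn}}{(q;q)_m(q;q)_n}=\sum_{k=0}^{\min(m,n)}\frac{(-1)^k q^{k(k-1)/2}}{(q;q)_{m-k}(q;q)_{n-k}(q;q)_k},\qquad \forall\, m,n\in\mathbb{Z}_{\ge0},$$ is equivalent to the quantum five term identity $$\phi(\mathsf{u})\phi(\mathsf{v})=\phi(\mathsf{v})\,\phi(-\mathsf{v}\mathsf{u})\,\phi(\mathsf{u})$$ in the algebra $\mathcal{A}_q=\mathbb{C}_q[[\mathsf{u},\mathsf{v}]]$.
   Context: For $q\in]0,1[$ and $k\in\mathbb{Z}_{\ge0}$, $(x;q)_k:=\prod_{n=0}^{k-1}(1-q^nx)$. $\mathcal{A}_q=\mathbb{C}_q[[\mathsf{u},\mathsf{v}]]$ is the algebra of formal power series over $\mathbb{C}$ in two elements $\mathsf{u},\mathsf{v}$ satisfying the commutation relation $\mathsf{u}\mathsf{v}=q\,\mathsf{v}\mathsf{u}$; every element is uniquely a formal sum $\sum_{m,n\ge0}c_{m,n}\mathsf{v}^n\mathsf{u}^m$ with $c_{m,n}\in\mathbb{C}$. For $x\in\mathcal{A}_q$ without constant term, $\phi(x)$ denotes the formal series $\phi(x)=\sum_{n\ge0}\frac{x^n}{(q;q)_n}$ (the expansion of the $q$-exponential function $1/\prod_{n\ge0}(1-q^nx)$). *)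

theory Defs
  imports Complex_Main "HOL-Algebra.Module"
begin

definition qpoch :: "real \<Rightarrow> real \<Rightarrow> nat \<Rightarrow> real" where
  "qpoch x q k = (\<Prod>n<k. 1 - q ^ n * x)"

text \<open>
  A formal series \<open>\<Sum> c\<^sub>m\<^sub>,\<^sub>n v\<^sup>n u\<^sup>m\<close> is encoded by its coefficients: \<open>c m n\<close> is the
  coefficient of \<open>v\<^sup>n u\<^sup>m\<close>, with the powers of \<open>v\<close> standing on the left.
\<close>

type_synonym qseries = "nat \<Rightarrow> nat \<Rightarrow> complex"

text \<open>
  The relation \<open>u v = q v u\<close> gives \<open>(v\<^sup>j u\<^sup>i) (v\<^sup>l u\<^sup>k) = q\<^sup>i\<^sup>l v\<^sup>j\<^sup>+\<^sup>l u\<^sup>i\<^sup>+\<^sup>k\<close>; the product below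
  is its bilinear extension to formal series.
\<close>

definition qs_mult :: "real \<Rightarrow> qseries \<Rightarrow> qseries \<Rightarrow> qseries" where
  "qs_mult q a b = (\<lambda>m n. \<Sum>i\<le>m. \<Sum>j\<le>n.
     of_real q ^ (i * (n - j)) * a i j * b (m - i) (n - j))"

definition qs_monom :: "nat \<Rightarrow> nat \<Rightarrow> qseries" where
  "qs_monom i j = (\<lambda>m n. if m = i \<and> n = j then 1 else 0)"

definition Aq :: "real \<Rightarrow> (complex, qseries) module" where
  "Aq q = \<lparr>carrier = UNIV, mult = qs_mult q, one = qs_monom 0 0,
           zero = (\<lambda>m n. 0), add = (\<lambda>a b m n. a m n + b m n),
           smult = (\<lambda>c a m n. c * a m n)\<rparr>"

definition qs_u :: qseries where "qs_u = qs_monom 1 0"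
definition qs_v :: qseries where "qs_v = qs_monom 0 1"

text \<open>
  The sum of a family of series in which every coefficient receives only finitely many nonzero
  contributions. For other families the offending coefficients are 0 by convention.
\<close>

definition formal_sum :: "('i \<Rightarrow> qseries) \<Rightarrow> qseries" where
  "formal_sum f = (\<lambda>m n. \<Sum>k | f k m n \<noteq> 0. f k m n)"

text \<open>
  Only meaningful for \<open>x\<close> without constant term: then the family is summable in the
  above sense, see \<open>finite_phi_terms\<close>.
\<close>

definition phi :: "real \<Rightarrow> qseries \<Rightarrow> qseries" where
  "phi q x = formal_sum (\<lambda>n. of_real (1 / qpoch q q n) \<odot>\<^bsub>Aq q\<^esub> (x [^]\<^bsub>Aq q\<^esub> n))"

lemma Aq_simps [simp]:
  "carrier (Aq q) = UNIV"
  "x \<otimes>\<^bsub>Aq q\<^esub> y = qs_mult q x y"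
  "\<one>\<^bsub>Aq q\<^esub> = qs_monom 0 0"
  "\<zero>\<^bsub>Aq q\<^esub> = (\<lambda>m n. 0)"
  "x \<oplus>\<^bsub>Aq q\<^esub> y = (\<lambda>m n. x m n + y m n)"
  "c \<odot>\<^bsub>Aq q\<^esub> x = (\<lambda>m n. c * x m n)"
  by (simp_all add: Aq_def)

lemma triangle_assoc:
  fixes f :: "nat \<Rightarrow> nat \<Rightarrow> nat \<Rightarrow> 'a::comm_monoid_add"
  shows "(\<Sum>j\<le>k. \<Sum>i\<le>j. f i (j - i) (n - j)) = (\<Sum>j\<le>k. \<Sum>i\<le>k - j. f j i (n - j - i))"
  by (induct k) (simp_all add: Suc_diff_le sum.distrib add.assoc)

lemma qs_mult_assoc: "qs_mult q (qs_mult q a b) c = qs_mult q a (qs_mult q b c)"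
proof (intro ext)
  fix m n
  define Q :: complex where "Q = of_real q"
  define G where "G = (\<lambda>i i' i'' j j' j''.
    Q ^ (i * j' + (i + i') * j'') * a i j * b i' j' * c i'' j'')"
  have "qs_mult q (qs_mult q a b) c m n =
      (\<Sum>p\<le>m. \<Sum>r\<le>n. \<Sum>i\<le>p. \<Sum>j\<le>r. G i (p - i) (m - p) j (r - j) (n - r))"
    unfolding qs_mult_def G_def Q_def[symmetric] sum_distrib_left sum_distrib_right
    by (intro sum.cong refl) (simp add: power_add mult_ac)
  also have "\<dots> = (\<Sum>p\<le>m. \<Sum>i\<le>p. \<Sum>r\<le>n. \<Sum>j\<le>r. G i (p - i) (m - p) j (r - j) (n - r))"
    by (intro sum.cong refl sum.swap)
  also have "\<dots> = (\<Sum>p\<le>m. \<Sum>i\<le>p. \<Sum>j\<le>n. \<Sum>s\<le>n - j. G i (p - i) (m - p) j s (n - j - s))"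
    by (intro sum.cong refl triangle_assoc)
  also have "\<dots> = (\<Sum>i\<le>m. \<Sum>p\<le>m - i. \<Sum>j\<le>n. \<Sum>s\<le>n - j. G i p (m - i - p) j s (n - j - s))"
    by (rule triangle_assoc)
  also have "\<dots> = (\<Sum>i\<le>m. \<Sum>j\<le>n. \<Sum>p\<le>m - i. \<Sum>s\<le>n - j. G i p (m - i - p) j s (n - j - s))"
    by (intro sum.cong refl sum.swap)
  also have "\<dots> = qs_mult q a (qs_mult q b c) m n"
    unfolding qs_mult_def G_def Q_def[symmetric] sum_distrib_left sum_distrib_right
  proof (intro sum.cong refl)
    fix i j p s
    assume "i \<in> {..m}" "j \<in> {..n}" "p \<in> {..m - i}" "s \<in> {..n - j}"
    then have "i * s + (i + p) * (n - j - s) = i * (n - j) + p * (n - j - s)"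
      by (auto simp: algebra_simps dest!: le_Suc_ex)
    then show "Q ^ (i * s + (i + p) * (n - j - s)) * a i j * b p s * c (m - i - p) (n - j - s) =
        Q ^ (i * (n - j)) * a i j *
          (Q ^ (p * (n - j - s)) * b p s * c (m - i - p) (n - j - s))"
      by (simp add: power_add mult_ac)
  qed
  finally show "qs_mult q (qs_mult q a b) c m n = qs_mult q a (qs_mult q b c) m n" .
qed

lemma qs_mult_monom_left:
  "qs_mult q (qs_monom i j) b m n =
     (if i \<le> m \<and> j \<le> n then of_real q ^ (i * (n - j)) * b (m - i) (n - j) else 0)"
proof -
  have "qs_mult q (qs_monom i j) b m n = (\<Sum>i'\<le>m. \<Sum>j'\<le>n. if j' = j then if i' = i then
     of_real q ^ (i * (n - j)) * b (m - i) (n - j) else 0 else 0)"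
    unfolding qs_mult_def qs_monom_def by (intro sum.cong refl) auto
  then show ?thesis by (cases "j \<le> n") simp_all
qed

lemma qs_mult_one_right: "qs_mult q a (qs_monom 0 0) = a"
proof (intro ext)
  fix m n
  have "qs_mult q a (qs_monom 0 0) m n = (\<Sum>i\<le>m. \<Sum>j\<le>n. if j = n then if i = m then a m n else 0 else 0)"
    unfolding qs_mult_def qs_monom_def by (intro sum.cong refl) auto
  then show "qs_mult q a (qs_monom 0 0) m n = a m n" by simp
qed

lemma qs_mult_monom:
  "qs_mult q (qs_monom i j) (qs_monom k l) =
     (\<lambda>m n. of_real q ^ (i * l) * qs_monom (i + k) (j + l) m n)"
  by (intro ext, subst qs_mult_monom_left) (auto simp: qs_monom_def)

lemma ring_Aq: "ring (Aq q)"
proof (rule ringI)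
  show "abelian_group (Aq q)"
  proof (rule abelian_groupI)
    fix x :: qseries
    show "\<exists>y\<in>carrier (Aq q). y \<oplus>\<^bsub>Aq q\<^esub> x = \<zero>\<^bsub>Aq q\<^esub>"
      by (rule bexI[of _ "\<lambda>m n. - x m n"]) auto
  qed (auto simp: add_ac)
  show "monoid (Aq q)"
    by (rule monoidI)
      (auto simp: qs_mult_assoc qs_mult_one_right qs_mult_monom_left fun_eq_iff)
qed (auto simp: qs_mult_def fun_eq_iff algebra_simps sum.distrib)

lemma smult_mult_Aq:
  "(c \<odot>\<^bsub>Aq q\<^esub> x) \<otimes>\<^bsub>Aq q\<^esub> y = c \<odot>\<^bsub>Aq q\<^esub> (x \<otimes>\<^bsub>Aq q\<^esub> y)"
  "x \<otimes>\<^bsub>Aq q\<^esub> (c \<odot>\<^bsub>Aq q\<^esub> y) = c \<odot>\<^bsub>Aq q\<^esub> (x \<otimes>\<^bsub>Aq q\<^esub> y)"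
  by (auto simp: qs_mult_def fun_eq_iff sum_distrib_left mult_ac)

lemma minus_Aq: "\<ominus>\<^bsub>Aq q\<^esub> x = (\<lambda>m n. - x m n)"
proof -
  interpret ring "Aq q" by (rule ring_Aq)
  show ?thesis by (rule minus_equality) auto
qed

lemma u_v_commute: "qs_u \<otimes>\<^bsub>Aq q\<^esub> qs_v = of_real q \<odot>\<^bsub>Aq q\<^esub> (qs_v \<otimes>\<^bsub>Aq q\<^esub> qs_u)"
  by (simp add: qs_u_def qs_v_def qs_mult_monom)

lemma u_pow: "qs_u [^]\<^bsub>Aq q\<^esub> (k::nat) = qs_monom k 0"
proof -
  interpret ring "Aq q" by (rule ring_Aq)
  show ?thesis by (induct k) (simp_all, simp add: qs_u_def qs_mult_monom)
qed

lemma v_pow: "qs_v [^]\<^bsub>Aq q\<^esub> (k::nat) = qs_monom 0 k"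
proof -
  interpret ring "Aq q" by (rule ring_Aq)
  show ?thesis by (induct k) (simp_all, simp add: qs_v_def qs_mult_monom)
qed

lemma formal_expansion:
  "x = formal_sum (\<lambda>(m, n). c m n \<odot>\<^bsub>Aq q\<^esub>
         ((qs_v [^]\<^bsub>Aq q\<^esub> (n::nat)) \<otimes>\<^bsub>Aq q\<^esub> (qs_u [^]\<^bsub>Aq q\<^esub> (m::nat)))) \<longleftrightarrow> c = x"
proof -
  have "formal_sum (\<lambda>(m, n). c m n \<odot>\<^bsub>Aq q\<^esub>
         ((qs_v [^]\<^bsub>Aq q\<^esub> (n::nat)) \<otimes>\<^bsub>Aq q\<^esub> (qs_u [^]\<^bsub>Aq q\<^esub> (m::nat)))) = c"
    (is "formal_sum ?f = c")
  proof (intro ext)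
    fix m n
    have f: "?f k m n = (if k = (m, n) then c m n else 0)" for k
      by (cases k) (auto simp: u_pow v_pow qs_mult_monom, auto simp: qs_monom_def)
    have "{k. ?f k m n \<noteq> 0} = (if c m n = 0 then {} else {(m, n)})"
      unfolding f by auto
    then show "formal_sum ?f m n = c m n"
      unfolding formal_sum_def by (simp add: f del: Aq_simps split del: if_split split: if_splits)
  qed
  then show ?thesis by auto
qed

lemma pow_coeff_eq_0:
  fixes k :: nat
  assumes "x 0 0 = 0" "m + n < k"
  shows "(x [^]\<^bsub>Aq q\<^esub> k) m n = 0"
  using assms(2)
proof (induct k arbitrary: m n)
  case (Suc k)
  interpret ring "Aq q" by (rule ring_Aq)
  have "(x [^]\<^bsub>Aq q\<^esub> k) i j * x (m - i) (n - j) = 0" if "i \<le> m" "j \<le> n" for i j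
  proof (cases "i = m \<and> j = n")
    case False
    then have "i + j < k" using that Suc.prems by linarith
    then show ?thesis using Suc.hyps by simp
  qed (simp add: assms(1))
  then show ?case by (auto simp: qs_mult_def intro!: sum.neutral)
qed simp

lemma finite_phi_terms:
  assumes "x 0 0 = 0"
  shows "finite {k. (of_real (1 / qpoch q q k) \<odot>\<^bsub>Aq q\<^esub> (x [^]\<^bsub>Aq q\<^esub> k)) m n \<noteq> 0}"
proof (rule finite_subset)
  show "{k. (of_real (1 / qpoch q q k) \<odot>\<^bsub>Aq q\<^esub> (x [^]\<^bsub>Aq q\<^esub> k)) m n \<noteq> 0} \<subseteq> {..m + n}"
    using pow_coeff_eq_0[of x m n _ q, OF assms] by (auto simp: not_less[symmetric])
qed simp

end

theory Submission
  imports Defs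
begin

text \<open>
  Since \<open>(v u)\<^sup>k = q\<^bsup>k(k-1)/2\<^esup> v\<^sup>k u\<^sup>k\<close>, the coefficients of \<open>v\<^sup>n u\<^sup>m\<close> on the two sides of the five
  term identity are exactly the two sides of the \<open>(m, n)\<close>-th scalar identity.
\<close>

text \<open>Appending one more factor \<open>v u\<close> to \<open>v^k u^k\<close> moves
  \<open>u^k\<close> past a single \<open>v\<close>, which costs \<open>q^k\<close>; these costs add
  up to the triangular exponent.\<close>

lemma minus_vu_pow:
  "(\<ominus>\<^bsub>Aq q\<^esub> (qs_v \<otimes>\<^bsub>Aq q\<^esub> qs_u)) [^]\<^bsub>Aq q\<^esub> (k::nat) =
     (\<lambda>m n. of_real ((- 1) ^ k * q ^ (k * (k - 1) div 2)) * qs_monom k k m n)"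
proof -
  interpret ring "Aq q" by (rule ring_Aq)
  show ?thesis
  proof (induct k)
    case (Suc k)
    have T: "Suc k * (Suc k - 1) div 2 = k * (k - 1) div 2 + k"
      by (cases k) auto
    have vu: "\<ominus>\<^bsub>Aq q\<^esub> (qs_v \<otimes>\<^bsub>Aq q\<^esub> qs_u) = (\<lambda>m n. (- 1) * qs_monom 1 1 m n)"
      unfolding minus_Aq by (simp add: qs_u_def qs_v_def qs_mult_monom)
    have mult: "(\<lambda>m n. c * qs_monom k k m n) \<otimes>\<^bsub>Aq q\<^esub> (\<lambda>m n. d * qs_monom 1 1 m n) =
        (\<lambda>m n. c * d * of_real q ^ k * qs_monom (Suc k) (Suc k) m n)" for c d
      using smult_mult_Aq(1)[of q c "qs_monom k k"] smult_mult_Aq(2)[of q _ d "qs_monom 1 1"]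
      by (simp add: qs_mult_monom mult_ac)
    \<comment> \<open>The induction hypothesis has to rewrite the power first, since
      \<open>vu\<close> would also replace the base inside it.\<close>
    show ?case
      unfolding nat_pow_Suc Suc T unfolding vu mult by (simp add: power_add mult_ac)
  qed simp
qed

text \<open>Powers of \<open>u\<close>, \<open>v\<close> and \<open>-v u\<close> are scalar
  multiples of single monomials, so at most one exponent contributes to a given coefficient.\<close>

lemma phi_coeff_single:
  assumes "\<And>k::nat. k \<noteq> l \<Longrightarrow> (x [^]\<^bsub>Aq q\<^esub> k) m n = 0"
  shows "phi q x m n = of_real (1 / qpoch q q l) * (x [^]\<^bsub>Aq q\<^esub> l) m n"
proof -
  let ?t = "\<lambda>k. of_real (1 / qpoch q q k) * (x [^]\<^bsub>Aq q\<^esub> k) m n"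
  have "phi q x m n = sum ?t {k. ?t k \<noteq> 0}"
    by (simp add: phi_def formal_sum_def)
  also have "\<dots> = sum ?t {l}"
    \<comment> \<open>The support is empty if the \<open>l\<close>-th term vanishes as well, hence
      only an inclusion in \<open>{l}\<close>.\<close>
    by (rule sum.mono_neutral_left) (auto, use assms in blast)
  finally show ?thesis by simp
qed

lemma phi_u: "phi q qs_u m n = (if n = 0 then of_real (1 / qpoch q q m) else 0)"
  by (subst phi_coeff_single[of m]) (auto simp: u_pow qs_monom_def)

lemma phi_v: "phi q qs_v m n = (if m = 0 then of_real (1 / qpoch q q n) else 0)"
  by (subst phi_coeff_single[of n]) (auto simp: v_pow qs_monom_def)

lemma phi_minus_vu:
  "phi q (\<ominus>\<^bsub>Aq q\<^esub> (qs_v \<otimes>\<^bsub>Aq q\<^esub> qs_u)) m n =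
     (if m = n then of_real ((- 1) ^ n * q ^ (n * (n - 1) div 2) / qpoch q q n) else 0)"
  by (subst phi_coeff_single[of n])
    (auto simp: minus_vu_pow qs_monom_def simp del: Aq_simps)

text \<open>No \<open>v\<close> stands to the right of a \<open>u\<close>: only \<open>j = n\<close>
  survives, and the twist \<open>q^(i * (n - j))\<close> becomes 1.\<close>

lemma qs_mult_u_series_right:
  assumes "\<And>i j. j \<noteq> 0 \<Longrightarrow> b i j = 0"
  shows "qs_mult q a b m n = (\<Sum>i\<le>m. a i n * b (m - i) 0)"
  unfolding qs_mult_def
proof (intro sum.cong refl)
  fix i
  have "(\<Sum>j\<le>n. of_real q ^ (i * (n - j)) * a i j * b (m - i) (n - j)) =
      (\<Sum>j\<le>n. if j = n then a i n * b (m - i) 0 else 0)"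
    by (intro sum.cong) (auto simp: assms)
  then show "(\<Sum>j\<le>n. of_real q ^ (i * (n - j)) * a i j * b (m - i) (n - j)) = a i n * b (m - i) 0"
    by simp
qed

text \<open>Dually, the left factor has no \<open>u\<close> to move past a \<open>v\<close>, so
  \<open>i = 0\<close> removes the twist.\<close>

lemma qs_mult_v_series_left:
  assumes "\<And>i j. i \<noteq> 0 \<Longrightarrow> a i j = 0"
  shows "qs_mult q a b m n = (\<Sum>j\<le>n. a 0 j * b m (n - j))"
  unfolding qs_mult_def
proof (subst sum.swap, intro sum.cong refl)
  fix j
  have "(\<Sum>i\<le>m. of_real q ^ (i * (n - j)) * a i j * b (m - i) (n - j)) =
      (\<Sum>i\<le>m. if i = 0 then a 0 j * b m (n - j) else 0)"
    by (intro sum.cong) (auto simp: assms)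
  then show "(\<Sum>i\<le>m. of_real q ^ (i * (n - j)) * a i j * b (m - i) (n - j)) = a 0 j * b m (n - j)"
    by simp
qed

text \<open>Here all of \<open>u^m\<close> must cross \<open>v^n\<close>; the single surviving pair
  \<open>i = m\<close>, \<open>j = 0\<close> carries the full twist
  \<open>q^(m * n)\<close>.\<close>

lemma phi_u_phi_v_coeff:
  "(phi q qs_u \<otimes>\<^bsub>Aq q\<^esub> phi q qs_v) m n =
     of_real (q ^ (m * n) / (qpoch q q m * qpoch q q n))"
proof -
  have "(phi q qs_u \<otimes>\<^bsub>Aq q\<^esub> phi q qs_v) m n =
      (\<Sum>i\<le>m. \<Sum>j\<le>n. if j = 0 then if i = m then
        of_real (q ^ (m * n) / (qpoch q q m * qpoch q q n)) else 0 else 0)"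
    unfolding Aq_simps qs_mult_def by (intro sum.cong refl) (auto simp: phi_u phi_v)
  then show ?thesis by simp
qed

lemma phi_v_phi_minus_vu_coeff:
  "(phi q qs_v \<otimes>\<^bsub>Aq q\<^esub> phi q (\<ominus>\<^bsub>Aq q\<^esub> (qs_v \<otimes>\<^bsub>Aq q\<^esub> qs_u))) m n =
     (if m \<le> n then of_real ((- 1) ^ m * q ^ (m * (m - 1) div 2) /
        (qpoch q q (n - m) * qpoch q q m)) else 0)"
proof -
  have "(phi q qs_v \<otimes>\<^bsub>Aq q\<^esub> phi q (\<ominus>\<^bsub>Aq q\<^esub> (qs_v \<otimes>\<^bsub>Aq q\<^esub> qs_u))) m n =
      (\<Sum>j\<le>n. phi q qs_v 0 j * phi q (\<ominus>\<^bsub>Aq q\<^esub> (qs_v \<otimes>\<^bsub>Aq q\<^esub> qs_u)) m (n - j))"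
    \<comment> \<open>The instance opens only the outer product, so that \<open>phi_minus_vu\<close>
      still matches the inner one.\<close>
    unfolding Aq_simps(2)[of q "phi q qs_v"] by (rule qs_mult_v_series_left) (simp add: phi_v)
  \<comment> \<open>The diagonal factor forces \<open>n - j = m\<close>; the guard
    \<open>m \<le> n\<close> excludes the spurious \<open>j = 0\<close> from truncated
    subtraction.\<close>
  also have "\<dots> = (\<Sum>j\<le>n. if j = n - m then if m \<le> n then
      of_real ((- 1) ^ m * q ^ (m * (m - 1) div 2) / (qpoch q q (n - m) * qpoch q q m)) else 0 else 0)"
    unfolding phi_v phi_minus_vu by (intro sum.cong refl) auto
  finally show ?thesis by simp
qed

lemma five_term_rhs_coeff:
  "(phi q qs_v \<otimes>\<^bsub>Aq q\<^esub> phi q (\<ominus>\<^bsub>Aq q\<^esub> (qs_v \<otimes>\<^bsub>Aq q\<^esub> qs_u)) \<otimes>\<^bsub>Aq q\<^esub> phi q qs_u) m n =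
     of_real (\<Sum>k = 0..min m n. (- 1) ^ k * q ^ (k * (k - 1) div 2) /
       (qpoch q q (m - k) * qpoch q q (n - k) * qpoch q q k))"
proof -
  let ?vw = "phi q qs_v \<otimes>\<^bsub>Aq q\<^esub> phi q (\<ominus>\<^bsub>Aq q\<^esub> (qs_v \<otimes>\<^bsub>Aq q\<^esub> qs_u))"
  let ?t = "\<lambda>k. (- 1) ^ k * q ^ (k * (k - 1) div 2) /
       (qpoch q q (m - k) * qpoch q q (n - k) * qpoch q q k)"
  have "(?vw \<otimes>\<^bsub>Aq q\<^esub> phi q qs_u) m n = (\<Sum>k\<le>m. ?vw k n * phi q qs_u (m - k) 0)"
    unfolding Aq_simps(2)[of q ?vw] by (rule qs_mult_u_series_right) (simp add: phi_u)
  \<comment> \<open>The term \<open>k\<close> pairs \<open>v^(n - k)\<close>,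
    \<open>(-v u)^k\<close> and \<open>u^(m - k)\<close>.\<close>
  also have "\<dots> = (\<Sum>k\<le>m. if k \<le> n then of_real (?t k) else 0)"
    unfolding phi_v_phi_minus_vu_coeff phi_u by (intro sum.cong refl) (simp add: mult_ac)
  also have "\<dots> = (\<Sum>k = 0..min m n. of_real (?t k))"
    by (rule sum.mono_neutral_cong_right) auto
  finally show ?thesis by simp
qed

theorem proposition2:
  fixes q :: real
  assumes "0 < q" and "q < 1"
  shows "(\<forall>m n :: nat.
            q ^ (m * n) / (qpoch q q m * qpoch q q n) =
            (\<Sum>k = 0..min m n. (-1) ^ k * q ^ (k * (k - 1) div 2) /
               (qpoch q q (m - k) * qpoch q q (n - k) * qpoch q q k)))
         \<longleftrightarrow>
         phi q qs_u \<otimes>\<^bsub>Aq q\<^esub> phi q qs_v =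
         phi q qs_v \<otimes>\<^bsub>Aq q\<^esub> phi q (\<ominus>\<^bsub>Aq q\<^esub> (qs_v \<otimes>\<^bsub>Aq q\<^esub> qs_u)) \<otimes>\<^bsub>Aq q\<^esub> phi q qs_u"
  \<comment> \<open>Series are equal iff all coefficients are, and injectivity of
    \<open>of_real\<close> brings these equations back to the reals.\<close>
  unfolding fun_eq_iff phi_u_phi_v_coeff five_term_rhs_coeff of_real_eq_iff ..

end
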